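(* Let $R$ be a distribution distance function on $\mathcal D_n$ and $r\ge0$. The robust Nadaraya-Watson formulation $$z^r\in\arg\min_z c_n(z,D_{\mathrm{tr}},x_0),\qquad c_n(z,D_{\mathrm{tr}},x_0)=\sup\{\mathrm E^n_D[L(z,y)\mid x=x_0]:\ D\in\mathcal D_n,\ R(D,D_{\mathrm{tr}})\le r\},$$ can be reformulated as the convex optimization problem $z^r\in\arg\min_z c_n(z,D_{\mathrm{tr}},x_0)$ with $$\begin{array}{rrl}c_n(z,D_{\mathrm{tr}},x_0)=&\displaystyle\sup_{s>0,\,P\ge 0}&\sum_{(\bar x,\bar y)\in\Omega_n}w_n(\bar x,x_0)\,L(z,\bar y)\,P[\bar x,\bar y]\\ &\text{s.t.}& s\,R(P/s,D_{\mathrm{tr}})\le s\,r,\\ &&\sum_{(\bar x,\bar y)\in\Omega_n}P[\bar x,\bar y]=s,\quad\sum_{(\bar x,\bar y)\in\Omega_n}w_n(\bar x,x_0)P[\bar x,\bar y]=1,\end{array}$$ the supremum being over $s>0$ and $P:\Omega_n\to[0,\infty)$; that is, this identity holds for every $z$, and $z\mapsto c_n(z,D_{\mathrm{tr}},x_0)$ is convex.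
   Context: Data. Let $\bar d_1=(\bar x_1,\bar y_1),\dots,\bar d_n=(\bar x_n,\bar y_n)$ be a fixed finite list (training data, $n\ge1$) of points in $\Omega\subseteq\mathbb R^{\dim(x)}\times\mathbb R^{\dim(y)}$, $\Omega_n$ the finite set of distinct points in the list, $\mathcal D_n$ the set of all probability distributions on $\Omega_n$, and $D_{\mathrm{tr}}=\frac1n\sum_{i=1}^n\delta_{\bar d_i}$. Fix a context of interest $x_0\in\mathbb R^{\dim(x)}$. $w_n(\bar x,x_0)>0$ is a positive weighing function. $L(z,\bar y)\in\mathbb R_+\cup\{+\infty\}$ is convex in the decision $z\in\mathbb R^{\dim(z)}$ for each $\bar y$ and measurable in $\bar y$ for each $z$. Convention: $0\cdot(+\infty)=0$. Nadaraya-Watson estimator (the case where the number of neighbors is $k(n)=n$, i.e. all observations are used): for $D\in\mathcal D_n$, $$\mathrm E^n_D[L(z,y)\mid x=x_0]=\frac{\sum_{(\bar x,\bar y)\in\Omega_n}L(z,\bar y)\,w_n(\bar x,x_0)\,D[\bar x,\bar y]}{\sum_{(\bar x,\bar y)\in\Omega_n}w_n(\bar x,x_0)\,D[\bar x,\bar y]}.$$ Distribution distance function: a function $R:\mathcal D_n\times\mathcal D_n\to[0,+\infty]$ such that (i) $R(D,D')\ge0$ for all $D,D'$, and $R(D',D)=0$ iff $D'=D$; (ii) $D\mapsto R(D,D')$ is convex for each fixed $D'$. *)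

theory Defs
  imports "HOL-Probability.Probability"
begin

text \<open>
  Losses take values in \<open>[0, \<infinity>]\<close>, i.e. in \<^typ>\<open>ennreal\<close>, whose multiplication satisfies the
  convention \<open>0 * \<infinity> = 0\<close>. The library's \<open>convex_on\<close> covers only real-valued functions.
\<close>

definition convex_ennreal :: "('z::real_vector \<Rightarrow> ennreal) \<Rightarrow> bool" where
  "convex_ennreal f \<longleftrightarrow>
     (\<forall>z1 z2. \<forall>t\<in>{0..1::real}.
        f (t *\<^sub>R z1 + (1 - t) *\<^sub>R z2) \<le> ennreal t * f z1 + ennreal (1 - t) * f z2)"

definition dists_on :: "'a set \<Rightarrow> 'a pmf set" where
  "dists_on S = {D. set_pmf D \<subseteq> S}"

definition sample_points :: "nat \<Rightarrow> (nat \<Rightarrow> 'a) \<Rightarrow> 'a set" where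
  "sample_points n d = d ` {1..n}"

text \<open>
  The empirical distribution \<open>1/n * (\<Sum>i = 1..n. \<delta>(d i))\<close>: the law of \<open>d i\<close> for a
  uniformly drawn index \<open>i\<close>, so repeated points are counted with their multiplicity.
\<close>

definition empirical :: "nat \<Rightarrow> (nat \<Rightarrow> 'a) \<Rightarrow> 'a pmf" where
  "empirical n d = map_pmf d (pmf_of_set {1..n})"

text \<open>
  Nonnegativity of \<open>R\<close> is carried by its type. Convexity in the first argument is stated
  through the distribution \<open>D\<close> whose mass function is the mixture of those of \<open>D1\<close> and \<open>D2\<close>.
\<close>

definition distribution_distance :: "'a set \<Rightarrow> ('a pmf \<Rightarrow> 'a pmf \<Rightarrow> ennreal) \<Rightarrow> bool" where
  "distribution_distance S R \<longleftrightarrow>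
     (\<forall>D\<in>dists_on S. \<forall>D'\<in>dists_on S. R D' D = 0 \<longleftrightarrow> D' = D) \<and>
     (\<forall>D'\<in>dists_on S. \<forall>D1\<in>dists_on S. \<forall>D2\<in>dists_on S. \<forall>D\<in>dists_on S. \<forall>t\<in>{0..1::real}.
        (\<forall>a. pmf D a = t * pmf D1 a + (1 - t) * pmf D2 a) \<longrightarrow>
        R D D' \<le> ennreal t * R D1 D' + ennreal (1 - t) * R D2 D')"

definition nw_estimate ::
  "('x \<times> 'y) set \<Rightarrow> ('x \<Rightarrow> 'x \<Rightarrow> real) \<Rightarrow> 'x \<Rightarrow> ('y \<Rightarrow> ennreal) \<Rightarrow> ('x \<times> 'y) pmf \<Rightarrow> ennreal" where
  "nw_estimate S w x0 g D =
     (\<Sum>(x, y)\<in>S. g y * ennreal (w x x0) * ennreal (pmf D (x, y))) /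
     (\<Sum>(x, y)\<in>S. ennreal (w x x0) * ennreal (pmf D (x, y)))"

definition robust_nw_cost ::
  "('x \<times> 'y) set \<Rightarrow> ('x \<Rightarrow> 'x \<Rightarrow> real) \<Rightarrow> 'x \<Rightarrow> ('z \<Rightarrow> 'y \<Rightarrow> ennreal) \<Rightarrow>
   (('x \<times> 'y) pmf \<Rightarrow> ('x \<times> 'y) pmf \<Rightarrow> ennreal) \<Rightarrow> real \<Rightarrow> ('x \<times> 'y) pmf \<Rightarrow> 'z \<Rightarrow> ennreal" where
  "robust_nw_cost S w x0 L R r Dtr z =
     (SUP D \<in> {D \<in> dists_on S. R D Dtr \<le> ennreal r}. nw_estimate S w x0 (L z) D)"

text \<open>
  Turns a mass function on \<open>S\<close> into a distribution. It is meaningful only if \<open>Q\<close> is nonnegative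
  on \<open>S\<close> and sums to one there; values of \<open>Q\<close> off \<open>S\<close> are ignored.
\<close>

definition dist_of :: "'a set \<Rightarrow> ('a \<Rightarrow> real) \<Rightarrow> 'a pmf" where
  "dist_of S Q = embed_pmf (\<lambda>a. if a \<in> S then Q a else 0)"

text \<open>
  The remaining constraints make \<open>P / s\<close> a probability mass function on \<open>S\<close>, so
  \<^const>\<open>dist_of\<close> is meaningful at every feasible point.
\<close>

definition reformulation_feasible ::
  "('x \<times> 'y) set \<Rightarrow> ('x \<Rightarrow> 'x \<Rightarrow> real) \<Rightarrow> 'x \<Rightarrow>
   (('x \<times> 'y) pmf \<Rightarrow> ('x \<times> 'y) pmf \<Rightarrow> ennreal) \<Rightarrow> real \<Rightarrow> ('x \<times> 'y) pmf \<Rightarrow>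
   (real \<times> ('x \<times> 'y \<Rightarrow> real)) set" where
  "reformulation_feasible S w x0 R r Dtr =
     {(s, P). s > 0 \<and> (\<forall>a\<in>S. P a \<ge> 0) \<and>
        ennreal s * R (dist_of S (\<lambda>a. P a / s)) Dtr \<le> ennreal s * ennreal r \<and>
        (\<Sum>a\<in>S. P a) = s \<and>
        (\<Sum>(x, y)\<in>S. w x x0 * P (x, y)) = 1}"

definition reformulated_cost ::
  "('x \<times> 'y) set \<Rightarrow> ('x \<Rightarrow> 'x \<Rightarrow> real) \<Rightarrow> 'x \<Rightarrow> ('z \<Rightarrow> 'y \<Rightarrow> ennreal) \<Rightarrow>
   (('x \<times> 'y) pmf \<Rightarrow> ('x \<times> 'y) pmf \<Rightarrow> ennreal) \<Rightarrow> real \<Rightarrow> ('x \<times> 'y) pmf \<Rightarrow> 'z \<Rightarrow> ennreal" where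
  "reformulated_cost S w x0 L R r Dtr z =
     (SUP (s, P) \<in> reformulation_feasible S w x0 R r Dtr.
        \<Sum>(x, y)\<in>S. ennreal (w x x0) * L z y * ennreal (P (x, y)))"

end

theory Submission
  imports Defs
begin

text \<open>
  The Nadaraya-Watson estimate is a linear-fractional function of the distribution \<open>D\<close>: both
  numerator and denominator are linear in \<open>D\<close>, so rescaling \<open>D\<close> by a factor \<open>s\<close> leaves the ratio
  unchanged. As the weights are positive, the denominator is positive, and \<open>s\<close> can be chosen as its
  inverse. The rescaled mass function \<open>P = s D\<close> then has denominator \<open>1\<close>, and the ratio has become
  the linear objective of the reformulation; this is the Charnes-Cooper transformation. Conversely,
  a feasible pair \<open>(s, P)\<close> yields the distribution \<open>P / s\<close>. The lemma
  \<open>nw_estimate_homogenized\<close> identifies the two objectives, the constraint on the distance is only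
  multiplied by \<open>s\<close>, and each direction of the correspondence gives one inequality between the
  two suprema.

  Convexity in the decision can be read off the original formulation: for a fixed distribution the
  estimate is a combination of the convex losses with nonnegative coefficients, and a pointwise
  supremum of convex functions is convex.
\<close>

lemma convex_ennreal_cmult:
  assumes "convex_ennreal f"
  shows "convex_ennreal (\<lambda>z. c * f z)"
  unfolding convex_ennreal_def
proof (intro allI ballI)
  fix z1 z2 and t :: real
  assume t: "t \<in> {0..1}"
  have "c * f (t *\<^sub>R z1 + (1 - t) *\<^sub>R z2) \<le> c * (ennreal t * f z1 + ennreal (1 - t) * f z2)"
    using assms t by (intro mult_left_mono) (auto simp: convex_ennreal_def)
  also have "\<dots> = ennreal t * (c * f z1) + ennreal (1 - t) * (c * f z2)"
    by (simp add: distrib_left mult_ac)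
  finally show "c * f (t *\<^sub>R z1 + (1 - t) *\<^sub>R z2) \<le> ennreal t * (c * f z1) + ennreal (1 - t) * (c * f z2)" .
qed

lemma convex_ennreal_sum:
  assumes "\<And>a. a \<in> A \<Longrightarrow> convex_ennreal (f a)"
  shows "convex_ennreal (\<lambda>z. \<Sum>a\<in>A. f a z)"
  unfolding convex_ennreal_def
proof (intro allI ballI)
  fix z1 z2 and t :: real
  assume t: "t \<in> {0..1}"
  have "(\<Sum>a\<in>A. f a (t *\<^sub>R z1 + (1 - t) *\<^sub>R z2))
      \<le> (\<Sum>a\<in>A. ennreal t * f a z1 + ennreal (1 - t) * f a z2)"
    using assms t by (intro sum_mono) (auto simp: convex_ennreal_def)
  also have "\<dots> = ennreal t * (\<Sum>a\<in>A. f a z1) + ennreal (1 - t) * (\<Sum>a\<in>A. f a z2)"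
    by (simp add: sum.distrib sum_distrib_left)
  finally show "(\<Sum>a\<in>A. f a (t *\<^sub>R z1 + (1 - t) *\<^sub>R z2))
      \<le> ennreal t * (\<Sum>a\<in>A. f a z1) + ennreal (1 - t) * (\<Sum>a\<in>A. f a z2)" .
qed

lemma convex_ennreal_SUP:
  assumes "\<And>i. i \<in> I \<Longrightarrow> convex_ennreal (f i)"
  shows "convex_ennreal (\<lambda>z. SUP i\<in>I. f i z)"
  unfolding convex_ennreal_def
proof (intro allI ballI SUP_least)
  fix z1 z2 i and t :: real
  assume t: "t \<in> {0..1}" and i: "i \<in> I"
  have "f i (t *\<^sub>R z1 + (1 - t) *\<^sub>R z2) \<le> ennreal t * f i z1 + ennreal (1 - t) * f i z2"
    using assms[OF i] t by (auto simp: convex_ennreal_def)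
  also have "\<dots> \<le> ennreal t * (SUP i\<in>I. f i z1) + ennreal (1 - t) * (SUP i\<in>I. f i z2)"
    by (intro add_mono mult_left_mono SUP_upper i) auto
  finally show "f i (t *\<^sub>R z1 + (1 - t) *\<^sub>R z2)
      \<le> ennreal t * (SUP i\<in>I. f i z1) + ennreal (1 - t) * (SUP i\<in>I. f i z2)" .
qed

lemma convex_nw_estimate:
  assumes "\<And>y. convex_ennreal (\<lambda>z. L z y)"
  shows "convex_ennreal (\<lambda>z. nw_estimate S w x0 (L z) D)"
proof -
  let ?c = "inverse (\<Sum>(x, y)\<in>S. ennreal (w x x0) * ennreal (pmf D (x, y)))"
  have "nw_estimate S w x0 (L z) D
      = (\<Sum>a\<in>S. (?c * ennreal (w (fst a) x0) * ennreal (pmf D a)) * L z (snd a))" for z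
    by (simp add: nw_estimate_def divide_ennreal_def sum_distrib_left case_prod_beta mult_ac)
  then show ?thesis
    using assms by (simp add: convex_ennreal_sum convex_ennreal_cmult)
qed

lemma convex_robust_nw_cost:
  assumes "\<And>y. convex_ennreal (\<lambda>z. L z y)"
  shows "convex_ennreal (robust_nw_cost S w x0 L R r Dtr)"
  using convex_ennreal_SUP[OF convex_nw_estimate[OF assms]]
  by (simp add: robust_nw_cost_def[abs_def])

lemma pmf_dist_of:
  assumes "finite S" and "\<And>a. a \<in> S \<Longrightarrow> Q a \<ge> 0" and "(\<Sum>a\<in>S. Q a) = 1"
  shows "pmf (dist_of S Q) a = (if a \<in> S then Q a else 0)"
proof -
  have "(\<integral>\<^sup>+ a. ennreal (if a \<in> S then Q a else 0) \<partial>count_space UNIV)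
      = (\<Sum>a\<in>S. ennreal (if a \<in> S then Q a else 0))"
    using assms(1) by (intro nn_integral_count_space') auto
  also have "\<dots> = 1"
    using assms by (simp add: sum_ennreal)
  finally show ?thesis
    unfolding dist_of_def using assms(2) by (subst pmf_embed_pmf) auto
qed

lemma dist_of_in_dists_on:
  assumes "finite S" and "\<And>a. a \<in> S \<Longrightarrow> Q a \<ge> 0" and "(\<Sum>a\<in>S. Q a) = 1"
  shows "dist_of S Q \<in> dists_on S"
  using pmf_dist_of[OF assms] by (auto simp: dists_on_def set_pmf_iff split: if_splits)

lemma sum_pmf_dists_on:
  assumes "finite S" and "D \<in> dists_on S"
  shows "(\<Sum>a\<in>S. pmf D a) = 1"
  using assms by (simp add: dists_on_def sum_pmf_eq_1)

lemma dist_of_pmf: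
  assumes "finite S" and "D \<in> dists_on S"
  shows "dist_of S (pmf D) = D"
proof (rule pmf_eqI)
  fix a
  have "pmf D a = 0" if "a \<notin> S"
    using that assms(2) by (auto simp: dists_on_def set_pmf_iff)
  then show "pmf (dist_of S (pmf D)) a = pmf D a"
    using pmf_dist_of[OF assms(1) _ sum_pmf_dists_on[OF assms], of a] by auto
qed

text \<open>
  The normalization of \<open>P\<close> makes the denominator of the estimate equal to \<open>1 / s\<close>. Dividing by it
  is thus multiplication by the finite positive number \<open>s\<close>, which can be moved into the sum even
  when some losses are infinite.
\<close>

lemma nw_estimate_homogenized:
  assumes "s > 0" and w: "\<And>x x'. w x x' \<ge> 0"
    and P: "\<And>a. a \<in> S \<Longrightarrow> P a = s * pmf D a"
    and norm: "(\<Sum>(x, y)\<in>S. w x x0 * P (x, y)) = 1"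
  shows "nw_estimate S w x0 g D = (\<Sum>(x, y)\<in>S. ennreal (w x x0) * g y * ennreal (P (x, y)))"
proof -
  have "s * (\<Sum>a\<in>S. w (fst a) x0 * pmf D a) = (\<Sum>(x, y)\<in>S. w x x0 * P (x, y))"
    unfolding sum_distrib_left by (intro sum.cong) (auto simp: P)
  then have "(\<Sum>a\<in>S. w (fst a) x0 * pmf D a) = 1 / s"
    using norm \<open>s > 0\<close> by (simp add: field_simps)
  moreover have "(\<Sum>(x, y)\<in>S. ennreal (w x x0) * ennreal (pmf D (x, y)))
      = ennreal (\<Sum>a\<in>S. w (fst a) x0 * pmf D a)"
    using w by (simp add: case_prod_beta ennreal_mult' sum_ennreal[symmetric] del: sum_ennreal)
  ultimately have den: "(\<Sum>(x, y)\<in>S. ennreal (w x x0) * ennreal (pmf D (x, y))) = ennreal (1 / s)"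
    by simp
  have "nw_estimate S w x0 g D
      = ennreal s * (\<Sum>(x, y)\<in>S. g y * ennreal (w x x0) * ennreal (pmf D (x, y)))"
    using \<open>s > 0\<close> by (simp add: nw_estimate_def den divide_ennreal_def inverse_ennreal mult.commute)
  also have "\<dots> = (\<Sum>(x, y)\<in>S. ennreal (w x x0) * g y * ennreal (P (x, y)))"
    unfolding sum_distrib_left
    using \<open>s > 0\<close> by (intro sum.cong) (auto simp: P ennreal_mult' mult_ac)
  finally show ?thesis .
qed

text \<open>
  This is where positivity of the weights enters: it rules out a vanishing denominator of the
  estimate, so that every distribution on \<open>S\<close> can be rescaled to weighted mass \<open>1\<close>.
\<close>

lemma weighted_mass_pos:
  assumes "finite S" and "D \<in> dists_on S" and w: "\<And>x x'. w x x' > (0::real)"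
  shows "(\<Sum>(x, y)\<in>S. w x x0 * pmf D (x, y)) > 0"
proof -
  obtain a where a: "a \<in> set_pmf D"
    using set_pmf_not_empty by fast
  then have "a \<in> S"
    using assms(2) by (auto simp: dists_on_def)
  moreover have "w (fst a) x0 * pmf D a > 0"
    using a w by (simp add: pmf_positive)
  ultimately show ?thesis
    using assms(1) less_imp_le[OF w] by (auto simp: case_prod_beta intro!: sum_pos2[of S a])
qed

theorem robust_nw_cost_eq_reformulated_cost:
  assumes "finite S" and w: "\<And>x x'. w x x' > 0"
  shows "robust_nw_cost S w x0 L R r Dtr z = reformulated_cost S w x0 L R r Dtr z"
proof (rule antisym)
  show "robust_nw_cost S w x0 L R r Dtr z \<le> reformulated_cost S w x0 L R r Dtr z"
    unfolding robust_nw_cost_def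
  proof (rule SUP_least)
    fix D assume "D \<in> {D \<in> dists_on S. R D Dtr \<le> ennreal r}"
    then have D: "D \<in> dists_on S" "R D Dtr \<le> ennreal r"
      by auto
    define s where "s = 1 / (\<Sum>(x, y)\<in>S. w x x0 * pmf D (x, y))"
    define P where "P = (\<lambda>a. s * pmf D a)"
    have s: "s > 0"
      using weighted_mass_pos[OF \<open>finite S\<close> D(1), of w] w by (simp add: s_def)
    have "(\<Sum>(x, y)\<in>S. w x x0 * P (x, y)) = s * (\<Sum>(x, y)\<in>S. w x x0 * pmf D (x, y))"
      unfolding sum_distrib_left by (intro sum.cong) (auto simp: P_def)
    then have norm: "(\<Sum>(x, y)\<in>S. w x x0 * P (x, y)) = 1"
      using s by (auto simp: s_def)
    have "(\<lambda>a. P a / s) = pmf D"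
      using s by (simp add: P_def)
    then have "dist_of S (\<lambda>a. P a / s) = D"
      using dist_of_pmf[OF \<open>finite S\<close> D(1)] by simp
    moreover have "(\<Sum>a\<in>S. P a) = s"
      using sum_pmf_dists_on[OF \<open>finite S\<close> D(1)] by (simp add: P_def sum_distrib_left[symmetric])
    ultimately have "(s, P) \<in> reformulation_feasible S w x0 R r Dtr"
      using s norm D(2) by (auto simp: reformulation_feasible_def P_def intro!: mult_left_mono)
    moreover have "nw_estimate S w x0 (L z) D
        = (\<Sum>(x, y)\<in>S. ennreal (w x x0) * L z y * ennreal (P (x, y)))"
      using s w norm by (intro nw_estimate_homogenized) (auto simp: P_def less_imp_le)
    ultimately show "nw_estimate S w x0 (L z) D \<le> reformulated_cost S w x0 L R r Dtr z"
      unfolding reformulated_cost_def by (intro SUP_upper2[of "(s, P)"]) auto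
  qed
next
  show "reformulated_cost S w x0 L R r Dtr z \<le> robust_nw_cost S w x0 L R r Dtr z"
    unfolding reformulated_cost_def
  proof (rule SUP_least, clarify)
    fix s P assume "(s, P) \<in> reformulation_feasible S w x0 R r Dtr"
    then have s: "s > 0" and P: "\<And>a. a \<in> S \<Longrightarrow> P a \<ge> 0" and mass: "(\<Sum>a\<in>S. P a) = s"
      and dist: "ennreal s * R (dist_of S (\<lambda>a. P a / s)) Dtr \<le> ennreal s * ennreal r"
      and norm: "(\<Sum>(x, y)\<in>S. w x x0 * P (x, y)) = 1"
      by (auto simp: reformulation_feasible_def)
    define D where "D = dist_of S (\<lambda>a. P a / s)"
    have Q: "\<And>a. a \<in> S \<Longrightarrow> P a / s \<ge> 0" "(\<Sum>a\<in>S. P a / s) = 1"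
      using s P mass by (auto simp: sum_divide_distrib[symmetric])
    have "R D Dtr \<le> ennreal r"
      using dist s by (simp add: D_def ennreal_mult_le_mult_iff)
    moreover have "D \<in> dists_on S"
      unfolding D_def by (intro dist_of_in_dists_on \<open>finite S\<close> Q)
    moreover have "P a = s * pmf D a" if "a \<in> S" for a
      using that s pmf_dist_of[OF \<open>finite S\<close> Q] by (simp add: D_def)
    then have "nw_estimate S w x0 (L z) D
        = (\<Sum>(x, y)\<in>S. ennreal (w x x0) * L z y * ennreal (P (x, y)))"
      using s w norm by (intro nw_estimate_homogenized) (auto simp: less_imp_le)
    ultimately show "(\<Sum>(x, y)\<in>S. ennreal (w x x0) * L z y * ennreal (P (x, y)))
        \<le> robust_nw_cost S w x0 L R r Dtr z"
      unfolding robust_nw_cost_def by (intro SUP_upper2[of D]) auto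
  qed
qed

theorem corollary1:
  fixes \<Omega> :: "('x::euclidean_space \<times> 'y::euclidean_space) set"
    and n :: nat
    and d :: "nat \<Rightarrow> 'x \<times> 'y"
    and x0 :: 'x
    and w :: "nat \<Rightarrow> 'x \<Rightarrow> 'x \<Rightarrow> real"
    and L :: "'z::euclidean_space \<Rightarrow> 'y \<Rightarrow> ennreal"
    and R :: "('x \<times> 'y) pmf \<Rightarrow> ('x \<times> 'y) pmf \<Rightarrow> ennreal"
    and r :: real
  defines "\<Omega>n \<equiv> sample_points n d"
    and "Dtr \<equiv> empirical n d"
  assumes "n \<ge> 1"
    and "\<And>i. i \<in> {1..n} \<Longrightarrow> d i \<in> \<Omega>"
    and "\<And>x x'. w n x x' > 0"
    and "\<And>y. convex_ennreal (\<lambda>z. L z y)"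
    and "\<And>z. L z \<in> borel_measurable borel"
    and "distribution_distance \<Omega>n R"
    and "r \<ge> 0"
  shows "(\<forall>z. robust_nw_cost \<Omega>n (w n) x0 L R r Dtr z = reformulated_cost \<Omega>n (w n) x0 L R r Dtr z)
    \<and> convex_ennreal (robust_nw_cost \<Omega>n (w n) x0 L R r Dtr)
    \<and> (\<forall>zr. is_arg_min (robust_nw_cost \<Omega>n (w n) x0 L R r Dtr) (\<lambda>_. True) zr
         \<longleftrightarrow> is_arg_min (reformulated_cost \<Omega>n (w n) x0 L R r Dtr) (\<lambda>_. True) zr)"
proof -
  have "finite \<Omega>n"
    by (simp add: \<Omega>n_def sample_points_def)
  then have "robust_nw_cost \<Omega>n (w n) x0 L R r Dtr = reformulated_cost \<Omega>n (w n) x0 L R r Dtr"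
    using assms(5) by (intro ext robust_nw_cost_eq_reformulated_cost)
  moreover have "convex_ennreal (robust_nw_cost \<Omega>n (w n) x0 L R r Dtr)"
    using assms(6) by (rule convex_robust_nw_cost)
  ultimately show ?thesis
    by simp
qed

end
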